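(* Let $G$ be a finite simple digraph. Then $G$ is a partial $0$-DAG if and only if $G$ does not contain $K_2$ as a directed minor.
   Context: All digraphs are finite and simple: no self-loops and no multiple (parallel) edges; a pair of opposite edges $(u,v)$ and $(v,u)$ is allowed. An edge $(u,v)$ goes from its tail $u$ to its head $v$. $K_2$ is the digraph on two vertices $u,v$ with the two edges $(u,v)$ and $(v,u)$. **$k$-DAGs.** For $k\ge 0$, the class of $k$-DAGs is defined recursively. (1) A complete digraph with $k$ vertices (all edges $(u,v)$, $u\ne v$, present; for $k=0$ this is the null digraph) is a $k$-DAG. (2) A $k$-DAG with $n+1$ vertices can be constructed from a $k$-DAG $H$ with $n$ vertices by adding a new vertex $v$ and edges as follows: at most $k$ edges from $v$ to vertices of $H$ are added; and, if $X\subseteq V(H)$ is the set of heads of these edges, an edge from $u\in V(H)$ to $v$ is added if $(u,w)\in E(H)$ for all $w\in X\setminus\{u\}$ (if $X=\emptyset$ this condition holds for all $u\in V(H)$). A partial $k$-DAG is a subgraph of a $k$-DAG. **Directed minors.** In the following operations any resulting self-loops and multiple edges are removed. - Cycle contraction: for a directed cycle $C=\{v_1,\dots,v_l\}$ in $G$ (distinct vertices with $(v_i,v_{i+1})\in E(G)$ for $1\le i\le l-1$ and $(v_l,v_1)\in E(G)$), delete all vertices of $C$ and all edges incident with them, add a new vertex $w$, and for each $x\in V(G)\setminus C$ add $(x,w)$ if $(x,v_i)\in E(G)$ for some $i$, and add $(w,x)$ if $(v_i,x)\in E(G)$ for some $i$. - Out-contraction of an edge $(u,v)\in E(G)$: the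 new vertex set is $V(G)\setminus\{u\}$ and the new edge set is $(E(G)\cup\{(x,v):(x,u)\in E(G)\})\setminus\{(x,u),(u,x):x\in V(G)\}$. - In-contraction of an edge $(u,v)\in E(G)$: the new vertex set is $V(G)\setminus\{v\}$ and the new edge set is $(E(G)\cup\{(u,x):(v,x)\in E(G)\})\setminus\{(x,v),(v,x):x\in V(G)\}$. A digraph $H$ is a directed minor of $G$ if $H$ is isomorphic to a digraph obtained from $G$ by a (possibly empty) sequence of vertex deletions, edge deletions, cycle contractions, out-contractions and in-contractions, in any order. "$G$ contains $H$ as a directed minor" means that $H$ is a directed minor of $G$. *)

theory Defs
  imports "Graph_Theory.Graph_Theory"
begin

text \<open>
  Finite simple digraphs are the digraphs satisfying the locale predicate \<^const>\<open>pair_digraph\<close>: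
  finite vertex set, arcs are ordered pairs of distinct vertices.
\<close>

text \<open>
  In the step, the arcs into \<open>v\<close> are determined by \<open>H\<close> and \<open>X\<close>: they are all the arcs \<open>(u, v)\<close>
  meeting the condition, and no others.
\<close>

inductive k_dag :: "nat \<Rightarrow> 'a pair_pre_digraph \<Rightarrow> bool" for k :: nat where
  complete: "complete_digraph k (with_proj G) \<Longrightarrow> k_dag k G"
| add_vertex:
    "\<lbrakk>k_dag k H; v \<notin> pverts H; X \<subseteq> pverts H; card X \<le> k\<rbrakk> \<Longrightarrow>
      k_dag k \<lparr>pverts = insert v (pverts H),
        parcs = parcs H \<union> {(v, w) | w. w \<in> X}
          \<union> {(u, v) | u. u \<in> pverts H \<and> (\<forall>w \<in> X - {u}. (u, w) \<in> parcs H)}\<rparr>"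

text \<open>
  A \<open>k\<close>-DAG containing \<open>G\<close> may need more vertices than the vertex type of \<open>G\<close> has elements, so
  being a subgraph is understood up to isomorphism, with the \<open>k\<close>-DAG living on natural numbers.
\<close>

definition partial_k_dag :: "nat \<Rightarrow> 'a pair_pre_digraph \<Rightarrow> bool" where
  "partial_k_dag k G \<longleftrightarrow>
    (\<exists>(D :: nat pair_pre_digraph) S.
      k_dag k D \<and> subgraph (with_proj S) (with_proj D) \<and> digraph_iso (with_proj G) (with_proj S))"

definition delete_vertex :: "'a pair_pre_digraph \<Rightarrow> 'a \<Rightarrow> 'a pair_pre_digraph" where
  "delete_vertex G v =
    \<lparr>pverts = pverts G - {v}, parcs = {(x, y) \<in> parcs G. x \<noteq> v \<and> y \<noteq> v}\<rparr>"

definition delete_edge :: "'a pair_pre_digraph \<Rightarrow> 'a \<times> 'a \<Rightarrow> 'a pair_pre_digraph" where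
  "delete_edge G e = \<lparr>pverts = pverts G, parcs = parcs G - {e}\<rparr>"

definition contract_set :: "'a pair_pre_digraph \<Rightarrow> 'a set \<Rightarrow> 'a \<Rightarrow> 'a pair_pre_digraph" where
  "contract_set G C w =
    \<lparr>pverts = insert w (pverts G - C),
     parcs = {(x, y) \<in> parcs G. x \<notin> C \<and> y \<notin> C}
       \<union> {(x, w) | x. x \<in> pverts G - C \<and> (\<exists>c \<in> C. (x, c) \<in> parcs G)}
       \<union> {(w, x) | x. x \<in> pverts G - C \<and> (\<exists>c \<in> C. (c, x) \<in> parcs G)}\<rparr>"

text \<open>
  If both \<open>(u, v)\<close> and \<open>(v, u)\<close> are arcs, redirecting arcs creates a loop at the remaining end;
  it is removed by intersecting with the complement of \<^const>\<open>Id\<close>.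
\<close>

definition out_contract :: "'a pair_pre_digraph \<Rightarrow> 'a \<Rightarrow> 'a \<Rightarrow> 'a pair_pre_digraph" where
  "out_contract G u v =
    \<lparr>pverts = pverts G - {u},
     parcs = (parcs G \<union> {(x, v) | x. (x, u) \<in> parcs G})
       - ({(x, u) | x. x \<in> pverts G} \<union> {(u, x) | x. x \<in> pverts G}) - Id\<rparr>"

definition in_contract :: "'a pair_pre_digraph \<Rightarrow> 'a \<Rightarrow> 'a \<Rightarrow> 'a pair_pre_digraph" where
  "in_contract G u v =
    \<lparr>pverts = pverts G - {v},
     parcs = (parcs G \<union> {(u, x) | x. (v, x) \<in> parcs G})
       - ({(x, v) | x. x \<in> pverts G} \<union> {(v, x) | x. x \<in> pverts G}) - Id\<rparr>"

text \<open>
  A cycle is given by its list of arcs, so its vertices are the tails of these arcs.  The new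
  vertex \<open>w\<close> only has to be distinct from the vertices that survive; reusing the name of a deleted
  vertex keeps the contraction available when all elements of the vertex type are in use.
\<close>

inductive minor_step :: "'a pair_pre_digraph \<Rightarrow> 'a pair_pre_digraph \<Rightarrow> bool"
  for G :: "'a pair_pre_digraph" where
  vertex_deletion: "v \<in> pverts G \<Longrightarrow> minor_step G (delete_vertex G v)"
| edge_deletion: "e \<in> parcs G \<Longrightarrow> minor_step G (delete_edge G e)"
| cycle_contraction:
    "\<lbrakk>pre_digraph.cycle (with_proj G) p; C = fst ` set p; w \<notin> pverts G - C\<rbrakk> \<Longrightarrow>
      minor_step G (contract_set G C w)"
| out_contraction: "(u, v) \<in> parcs G \<Longrightarrow> minor_step G (out_contract G u v)"
| in_contraction: "(u, v) \<in> parcs G \<Longrightarrow> minor_step G (in_contract G u v)"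

definition directed_minor :: "'b pair_pre_digraph \<Rightarrow> 'a pair_pre_digraph \<Rightarrow> bool" where
  "directed_minor H G \<longleftrightarrow>
    (\<exists>G'. minor_step\<^sup>*\<^sup>* G G' \<and> digraph_iso (with_proj G') (with_proj H))"

definition K2 :: "nat pair_pre_digraph" where
  "K2 = \<lparr>pverts = {0, 1}, parcs = {(0, 1), (1, 0)}\<rparr>"

lemma pair_digraph_iff:
  "pair_digraph G \<longleftrightarrow>
    finite (pverts G) \<and> parcs G \<subseteq> pverts G \<times> pverts G \<and> parcs G \<inter> Id = {}"
proof
  assume "pair_digraph G"
  then interpret pair_digraph G .
  show "finite (pverts G) \<and> parcs G \<subseteq> pverts G \<times> pverts G \<and> parcs G \<inter> Id = {}"
    using pair_finite_verts by (auto dest: in_arcsD1 in_arcsD2 pair_no_loops)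
next
  assume G: "finite (pverts G) \<and> parcs G \<subseteq> pverts G \<times> pverts G \<and> parcs G \<inter> Id = {}"
  then have "finite (parcs G)"
    by (meson finite_SigmaI finite_subset)
  with G show "pair_digraph G"
    by unfold_locales auto
qed

lemma minor_step_pair_digraph:
  assumes "minor_step G H" "pair_digraph G"
  shows "pair_digraph H"
  using assms(1)
proof cases
  case (vertex_deletion v)
  then show ?thesis
    using assms(2) by (auto simp: pair_digraph_iff delete_vertex_def)
next
  case (edge_deletion e)
  then show ?thesis
    using assms(2) by (auto simp: pair_digraph_iff delete_edge_def)
next
  case (cycle_contraction p C w)
  then show ?thesis
    using assms(2) by (auto simp: pair_digraph_iff contract_set_def)
next
  case (out_contraction u v)
  then show ?thesis
    using assms(2) by (auto simp: pair_digraph_iff out_contract_def)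
next
  case (in_contraction u v)
  then show ?thesis
    using assms(2) by (auto simp: pair_digraph_iff in_contract_def)
qed

lemma k_dag_pair_digraph: "k_dag k G \<Longrightarrow> pair_digraph G"
proof (induction rule: k_dag.induct)
  case (complete G)
  then show ?case
    by (auto simp: pair_digraph_iff complete_digraph_pair_def)
next
  case (add_vertex H v X)
  then show ?case
    by (auto simp: pair_digraph_iff)
qed

end

theory Submission
  imports Defs
begin

text \<open>
  Both sides of the equivalence say that \<open>G\<close> has no directed cycle.

  For \<open>k = 0\<close> the recursive construction starts with the null digraph and adds, again and again, a
  vertex without out-neighbours that receives an arc from every older vertex.  So the \<open>0\<close>-DAGs are
  the transitive tournaments, which are acyclic, and conversely an acyclic digraph embeds into a
  transitive tournament along a topological numbering of its vertices
  (\<open>partial_0_dag_iff_acyclic\<close>).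

  Every minor operation keeps a digraph acyclic: deletions remove arcs, a cycle contraction cannot
  be applied at all, and the arcs created by contracting a single arc replace paths of length two
  (\<open>minor_step_acyclic\<close>).  As \<open>K2\<close> has a cycle, an acyclic digraph does not contain it.
  Conversely, a digraph with a cycle can be shrunk to \<open>K2\<close>.  If it has a pair of opposite arcs,
  delete all other vertices; otherwise out-contract an arc of a cycle, which has length at least
  three and so survives the contraction with one vertex less
  (\<open>not_acyclic_imp_directed_minor_K2\<close>).
\<close>

section \<open>Isomorphisms of digraphs without parallel arcs\<close>

text \<open>
  An isomorphism of digraphs also carries a map on arcs.  Without parallel arcs it is determined
  by the map on vertices.
\<close>

lemma digraph_iso_with_proj_iff:
  "digraph_iso (with_proj G) (with_proj H) \<longleftrightarrow>
    pair_wf_digraph G \<and>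
    (\<exists>f. inj_on f (pverts G) \<and> pverts H = f ` pverts G \<and> parcs H = map_prod f f ` parcs G)"
    (is "?L \<longleftrightarrow> ?R")
proof
  assume ?L
  then obtain h where h: "pre_digraph.digraph_isomorphism (with_proj G) h"
    and H: "with_proj H = app_iso h (with_proj G)"
    by (auto simp: digraph_iso_def)
  have tail_head: "iso_tail h = fst" "iso_head h = snd"
    using arg_cong[OF H, of tail] arg_cong[OF H, of head] by simp_all
  have "iso_arcs h a = map_prod (iso_verts h) (iso_verts h) a" if "a \<in> parcs G" for a
    using h that by (cases a) (auto simp: pre_digraph.digraph_isomorphism_def tail_head prod_eq_iff)
  then have "parcs H = map_prod (iso_verts h) (iso_verts h) ` parcs G"
    using arg_cong[OF H, of arcs] by simp
  moreover have "pverts H = iso_verts h ` pverts G"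
    using arg_cong[OF H, of verts] by simp
  ultimately show ?R
    using h by (auto simp: pre_digraph.digraph_isomorphism_def wf_digraph_wp_iff)
next
  assume ?R
  then obtain f where wf: "pair_wf_digraph G" and f: "inj_on f (pverts G)"
    and H: "pverts H = f ` pverts G" "parcs H = map_prod f f ` parcs G"
    by blast
  interpret pair_wf_digraph G by (fact wf)
  let ?h = "\<lparr>iso_verts = f, iso_arcs = map_prod f f, iso_head = snd, iso_tail = fst\<rparr>"
  have "parcs G \<subseteq> pverts G \<times> pverts G"
    by (auto dest: in_arcsD1 in_arcsD2)
  then have "inj_on (map_prod f f) (parcs G)"
    using f by (metis inj_on_subset map_prod_inj_on)
  then have "pre_digraph.digraph_isomorphism (with_proj G) ?h"
    using wf f by (auto simp: pre_digraph.digraph_isomorphism_def wf_digraph_wp_iff)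
  moreover have "with_proj H = app_iso ?h (with_proj G)"
    by (simp add: with_proj_def app_iso_def H)
  ultimately show ?L
    unfolding digraph_iso_def by blast
qed

lemma acyclic_map_prod_imageD:
  assumes "acyclic (map_prod f f ` R)"
  shows "acyclic R"
proof -
  have "(f x, f y) \<in> (map_prod f f ` R)\<^sup>+" if "(x, y) \<in> R\<^sup>+" for x y
    using that
  proof induction
    case (base y)
    then show ?case by (auto intro!: r_into_trancl)
  next
    case (step y z)
    then show ?case by (auto intro: trancl_into_trancl)
  qed
  then show ?thesis
    using assms by (fastforce simp: acyclic_def)
qed

lemma acyclic_of_digraph_iso:
  assumes "digraph_iso (with_proj G) (with_proj H)" "acyclic (parcs H)"
  shows "acyclic (parcs G)"
  using assms by (auto simp: digraph_iso_with_proj_iff intro: acyclic_map_prod_imageD)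

section \<open>Partial 0-DAGs are the acyclic digraphs\<close>

lemma acyclic_Un_arcs_to_new_vertex:
  assumes "acyclic R" "R \<subseteq> V \<times> V" "v \<notin> V"
  shows "acyclic (R \<union> V \<times> {v})"
proof -
  \<comment> \<open>Nothing leaves \<open>v\<close>, so a path can use a new arc only as its last arc.\<close>
  have "(x, y) \<in> R\<^sup>+ \<or> x \<in> V \<and> y = v" if "(x, y) \<in> (R \<union> V \<times> {v})\<^sup>+" for x y
    using that
  proof induction
    case (base y)
    then show ?case by auto
  next
    case (step y z)
    have "R\<^sup>+ \<subseteq> V \<times> V"
      using assms(2) by (simp add: trancl_subset_Sigma)
    with step assms(2,3) show ?case
      by (auto intro: trancl_into_trancl)
  qed
  then show ?thesis
    using assms(1,3) by (fastforce simp: acyclic_def)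
qed

lemma k_dag_0_acyclic: "k_dag 0 D \<Longrightarrow> acyclic (parcs D)"
proof (induction rule: k_dag.induct)
  case (complete G)
  then have "parcs G = {}"
    by (auto simp: complete_digraph_pair_def)
  then show ?case
    by (simp add: acyclic_def)
next
  case (add_vertex H v X)
  have H: "finite (pverts H)" "parcs H \<subseteq> pverts H \<times> pverts H"
    using k_dag_pair_digraph[OF add_vertex.hyps(1)] by (auto simp: pair_digraph_iff)
  then have "X = {}"
    using add_vertex.hyps finite_subset by fastforce
  then have "{(v, w) | w. w \<in> X} \<union> {(u, v) | u. u \<in> pverts H \<and> (\<forall>w \<in> X - {u}. (u, w) \<in> parcs H)}
      = pverts H \<times> {v}"
    by auto
  with acyclic_Un_arcs_to_new_vertex[OF add_vertex.IH H(2) add_vertex.hyps(2)]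
  show ?case
    by (simp add: Un_assoc)
qed

lemma k_dag_0_transitive_tournament:
  "k_dag 0 \<lparr>pverts = {..<n :: nat}, parcs = {(i, j). i < j \<and> j < n}\<rparr>"
proof (induction n)
  case 0
  show ?case
    by (rule k_dag.complete) (simp add: complete_digraph_pair_def)
next
  case (Suc n)
  have "\<lparr>pverts = {..<Suc n}, parcs = {(i, j). i < j \<and> j < Suc n}\<rparr>
      = \<lparr>pverts = insert n {..<n},
         parcs = {(i, j). i < j \<and> j < n} \<union> {(n, w) | w. w \<in> {}}
           \<union> {(u, n) | u. u \<in> {..<n} \<and> (\<forall>w \<in> {} - {u}. (u, w) \<in> {(i, j). i < j \<and> j < n})}\<rparr>"
    by auto
  with k_dag.add_vertex[OF Suc, of n "{}"] show ?case
    by simp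
qed

text \<open>
  A vertex has fewer strict predecessors than each of its out-neighbours.  To separate vertices
  with equally many predecessors, the number of predecessors is made the leading digit and an
  arbitrary numbering of the vertices the last digit.
\<close>

lemma acyclic_topological_numbering:
  assumes "finite V" "R \<subseteq> V \<times> V" "acyclic R"
  obtains f :: "'a \<Rightarrow> nat" where "inj_on f V" "\<And>x y. (x, y) \<in> R \<Longrightarrow> f x < f y"
proof -
  obtain g :: "'a \<Rightarrow> nat" and N where g: "g ` V = {i. i < N}" "inj_on g V"
    using finite_imp_inj_to_nat_seg[OF assms(1)] by blast
  have g_less: "g x < N" if "x \<in> V" for x
    using g(1) that by blast
  define h where "h x = card {z. (z, x) \<in> R\<^sup>+}" for x
  have h_less: "h x < h y" if xy: "(x, y) \<in> R" for x y
    unfolding h_def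
  proof (rule psubset_card_mono)
    have "{z. (z, y) \<in> R\<^sup>+} \<subseteq> V"
      using trancl_subset_Sigma[OF assms(2)] by auto
    then show "finite {z. (z, y) \<in> R\<^sup>+}"
      using assms(1) by (rule finite_subset)
    have "(x, x) \<notin> R\<^sup>+"
      using assms(3) by (simp add: acyclic_def)
    with xy show "{z. (z, x) \<in> R\<^sup>+} \<subset> {z. (z, y) \<in> R\<^sup>+}"
      by (auto intro: trancl_into_trancl)
  qed
  show ?thesis
  proof (rule that[of "\<lambda>x. h x * N + g x"])
    show "inj_on (\<lambda>x. h x * N + g x) V"
    proof (rule inj_onI)
      fix x y assume "x \<in> V" "y \<in> V" and eq: "h x * N + g x = h y * N + g y"
      have "g x = (h x * N + g x) mod N" "g y = (h y * N + g y) mod N"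
        using g_less \<open>x \<in> V\<close> \<open>y \<in> V\<close> by simp_all
      then show "x = y"
        using eq g(2) \<open>x \<in> V\<close> \<open>y \<in> V\<close> by (metis inj_onD)
    qed
    fix x y assume xy: "(x, y) \<in> R"
    then have "h x * N + g x < Suc (h x) * N"
      using g_less assms(2) by auto
    also have "\<dots> \<le> h y * N"
      using h_less[OF xy] by (intro mult_right_mono) auto
    finally show "h x * N + g x < h y * N + g y"
      by simp
  qed
qed

lemma partial_0_dag_iff_acyclic:
  assumes "pair_digraph G"
  shows "partial_k_dag 0 G \<longleftrightarrow> acyclic (parcs G)"
proof
  assume "partial_k_dag 0 G"
  then obtain D S :: "nat pair_pre_digraph" where "k_dag 0 D" and "subgraph (with_proj S) (with_proj D)"
    and iso: "digraph_iso (with_proj G) (with_proj S)"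
    by (auto simp: partial_k_dag_def)
  then have "acyclic (parcs S)"
    using k_dag_0_acyclic by (auto simp: subgraph_def intro: acyclic_subset)
  then show "acyclic (parcs G)"
    by (rule acyclic_of_digraph_iso[OF iso])
next
  assume acyc: "acyclic (parcs G)"
  have G: "finite (pverts G)" "parcs G \<subseteq> pverts G \<times> pverts G"
    using assms by (auto simp: pair_digraph_iff)
  obtain f :: "'a \<Rightarrow> nat"
    where f: "inj_on f (pverts G)" "\<And>x y. (x, y) \<in> parcs G \<Longrightarrow> f x < f y"
    using acyclic_topological_numbering[OF G acyc] by blast
  obtain n where n: "\<And>x. x \<in> pverts G \<Longrightarrow> f x < n"
    using G(1) finite_nat_set_iff_bounded[of "f ` pverts G"] by auto
  let ?D = "\<lparr>pverts = {..<n}, parcs = {(i, j). i < j \<and> j < n}\<rparr>"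
  let ?S = "\<lparr>pverts = f ` pverts G, parcs = map_prod f f ` parcs G\<rparr>"
  have "pair_wf_digraph G" "pair_wf_digraph ?S" "pair_wf_digraph ?D"
    using G(2) by (unfold_locales; force)+
  then have "digraph_iso (with_proj G) (with_proj ?S)" "subgraph (with_proj ?S) (with_proj ?D)"
    using f n G(2) by (auto simp: digraph_iso_with_proj_iff subgraph_def wf_digraph_wp_iff)
  then show "partial_k_dag 0 G"
    unfolding partial_k_dag_def using k_dag_0_transitive_tournament by blast
qed

section \<open>Digraphs without a K2 minor are the acyclic digraphs\<close>

lemma cycle_imp_not_acyclic:
  assumes "pair_wf_digraph G" "pre_digraph.cycle (with_proj G) p"
  shows "\<not> acyclic (parcs G)"
proof -
  interpret wf_digraph "with_proj G"
    using assms(1) by (simp add: wf_digraph_wp_iff)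
  obtain u where "awalk u p u" "p \<noteq> []"
    using assms(2) by (auto simp: cycle_def)
  then have "(u, u) \<in> (parcs G)\<^sup>+"
    using reachable1_awalkI by (metis with_proj_simps(3))
  then show ?thesis
    by (auto simp: acyclic_def)
qed

lemma minor_step_acyclic:
  assumes "minor_step G H" "pair_wf_digraph G" "acyclic (parcs G)"
  shows "acyclic (parcs H)"
  using assms(1)
proof cases
  case (vertex_deletion v)
  then show ?thesis
    by (auto simp: delete_vertex_def intro: acyclic_subset[OF assms(3)])
next
  case (edge_deletion e)
  then show ?thesis
    by (auto simp: delete_edge_def intro: acyclic_subset[OF assms(3)])
next
  case (cycle_contraction p C w)
  then show ?thesis
    using cycle_imp_not_acyclic assms(2,3) by blast
next
  case (out_contraction u v)
  then have "parcs H \<subseteq> (parcs G)\<^sup>+"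
    by (auto simp: out_contract_def intro: trancl_into_trancl)
  moreover have "acyclic ((parcs G)\<^sup>+)"
    using assms(3) by (simp add: acyclic_def)
  ultimately show ?thesis
    using acyclic_subset by blast
next
  case (in_contraction u v)
  then have "parcs H \<subseteq> (parcs G)\<^sup>+"
    by (auto simp: in_contract_def intro: trancl_into_trancl2)
  moreover have "acyclic ((parcs G)\<^sup>+)"
    using assms(3) by (simp add: acyclic_def)
  ultimately show ?thesis
    using acyclic_subset by blast
qed

lemma not_acyclic_of_opposite_arcs:
  assumes "(u, v) \<in> R" "(v, u) \<in> R"
  shows "\<not> acyclic R"
  using assms by (meson acyclic_def r_into_trancl trancl_into_trancl)

lemma acyclic_imp_not_directed_minor_K2:
  assumes "pair_digraph G" "acyclic (parcs G)"
  shows "\<not> directed_minor K2 G"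
proof
  assume "directed_minor K2 G"
  then obtain G' where steps: "minor_step\<^sup>*\<^sup>* G G'"
    and iso: "digraph_iso (with_proj G') (with_proj K2)"
    by (auto simp: directed_minor_def)
  from steps have "pair_digraph G' \<and> acyclic (parcs G')"
  proof induction
    case base
    with assms show ?case by simp
  next
    case (step H H')
    then show ?case
      using minor_step_pair_digraph minor_step_acyclic
      by (metis pair_digraph_def pair_fin_digraph_def)
  qed
  moreover have "digraph_iso (with_proj K2) (with_proj G')"
    using iso by (metis digraph_iso_swap digraph_iso_with_proj_iff wf_digraph_wp_iff)
  ultimately have "acyclic (parcs K2)"
    using acyclic_of_digraph_iso by blast
  moreover have "\<not> acyclic (parcs K2)"
    by (rule not_acyclic_of_opposite_arcs[of 0 1]) (simp_all add: K2_def)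
  ultimately show False
    by contradiction
qed

lemma digraph_iso_K2:
  assumes "pair_digraph G" "(u, v) \<in> parcs G" "(v, u) \<in> parcs G" "pverts G = {u, v}"
  shows "digraph_iso (with_proj G) (with_proj K2)"
proof -
  have "u \<noteq> v" "parcs G \<subseteq> {u, v} \<times> {u, v}" "parcs G \<inter> Id = {}"
    using assms by (auto simp: pair_digraph_iff)
  then have "parcs G = {(u, v), (v, u)}"
    using assms(2,3) by auto
  with \<open>u \<noteq> v\<close> assms(1,4) show ?thesis
    by (auto simp: digraph_iso_with_proj_iff K2_def pair_digraph_def pair_fin_digraph_def
        intro!: exI[of _ "\<lambda>x. if x = u then 0 else 1"])
qed

lemma trancl_first_visit:
  assumes "(v, u) \<in> R\<^sup>+" "v \<noteq> u"
  obtains x where "(v, x) \<in> (R - (UNIV \<times> {u} \<union> {u} \<times> UNIV))\<^sup>*" "(x, u) \<in> R"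
proof -
  let ?R = "R - (UNIV \<times> {u} \<union> {u} \<times> UNIV)"
  have "(v, y) \<in> ?R\<^sup>* \<and> y \<noteq> u \<or> (\<exists>x. (v, x) \<in> ?R\<^sup>* \<and> (x, u) \<in> R)" if "(v, y) \<in> R\<^sup>*" for y
    using that
  proof induction
    case base
    with assms(2) show ?case by simp
  next
    case (step y z)
    then show ?case
      by (cases "z = u") (auto intro: rtrancl_into_rtrancl)
  qed
  from this[of u] assms(1) show ?thesis
    using that by (auto dest: trancl_into_rtrancl)
qed

text \<open>
  The cycle through \<open>(u, v)\<close> is followed from \<open>v\<close> to its first return to \<open>u\<close>.  Its last arc
  \<open>(x, u)\<close> is redirected to \<open>(x, v)\<close>, and this closes a cycle unless \<open>x = v\<close>.
\<close>

lemma out_contract_not_acyclic: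
  assumes "(u, v) \<in> parcs G" "(v, u) \<in> (parcs G)\<^sup>+" "(v, u) \<notin> parcs G"
    and "pair_digraph G"
  shows "\<not> acyclic (parcs (out_contract G u v))"
proof -
  let ?R = "parcs G - (UNIV \<times> {u} \<union> {u} \<times> UNIV)" and ?S = "parcs (out_contract G u v)"
  have no_loop: "(x, x) \<notin> parcs G" for x
    using assms(4) by (auto simp: pair_digraph_iff)
  have "u \<noteq> v"
    using assms(1) no_loop by blast
  then obtain x where x: "(v, x) \<in> ?R\<^sup>*" "(x, u) \<in> parcs G"
    using assms(2) by (metis trancl_first_visit)
  have "x \<noteq> v" "x \<noteq> u"
    using x(2) assms(3) no_loop by auto
  then have "(x, v) \<in> ?S"
    using x(2) \<open>u \<noteq> v\<close> by (auto simp: out_contract_def)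
  moreover have "?R \<subseteq> ?S"
    using no_loop by (auto simp: out_contract_def)
  then have "(v, x) \<in> ?S\<^sup>*"
    using x(1) rtrancl_mono by blast
  ultimately show ?thesis
    by (meson acyclic_def rtrancl_into_trancl1)
qed

lemma directed_minor_of_minor_step:
  assumes "minor_step G H" "directed_minor K H"
  shows "directed_minor K G"
  using assms by (meson converse_rtranclp_into_rtranclp directed_minor_def)

lemma not_acyclic_imp_directed_minor_K2:
  assumes "pair_digraph G" "\<not> acyclic (parcs G)"
  shows "directed_minor K2 G"
  using assms
proof (induction "card (pverts G)" arbitrary: G rule: less_induct)
  case less
  have G: "finite (pverts G)" "parcs G \<subseteq> pverts G \<times> pverts G" "parcs G \<inter> Id = {}"
    using less.prems(1) by (auto simp: pair_digraph_iff)
  have shrink: "directed_minor K2 G"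
    if "minor_step G H" "pverts H = pverts G - {x}" "x \<in> pverts G" "\<not> acyclic (parcs H)" for H x
  proof -
    have "card (pverts H) < card (pverts G)"
      using that(2,3) G(1) by (metis card_Diff1_less)
    then have "directed_minor K2 H"
      using less.hyps minor_step_pair_digraph that(1,4) less.prems(1) by blast
    then show ?thesis
      using that(1) directed_minor_of_minor_step by blast
  qed
  show ?case
  proof (cases "\<exists>u v. (u, v) \<in> parcs G \<and> (v, u) \<in> parcs G")
    case True
    then obtain u v where uv: "(u, v) \<in> parcs G" "(v, u) \<in> parcs G"
      by blast
    show ?thesis
    proof (cases "pverts G = {u, v}")
      case True
      then show ?thesis
        using digraph_iso_K2[OF less.prems(1) uv] unfolding directed_minor_def by blast
    next
      case False
      then obtain x where x: "x \<in> pverts G" "x \<noteq> u" "x \<noteq> v"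
        using G(2) uv by auto
      then have "(u, v) \<in> parcs (delete_vertex G x)" "(v, u) \<in> parcs (delete_vertex G x)"
        using uv by (auto simp: delete_vertex_def)
      then have "\<not> acyclic (parcs (delete_vertex G x))"
        by (rule not_acyclic_of_opposite_arcs)
      with shrink[OF vertex_deletion[OF x(1)]] x(1) show ?thesis
        by (simp add: delete_vertex_def)
    qed
  next
    case False
    obtain u where "(u, u) \<in> (parcs G)\<^sup>+"
      using less.prems(2) by (auto simp: acyclic_def)
    then obtain v where uv: "(u, v) \<in> parcs G" "(v, u) \<in> (parcs G)\<^sup>*"
      by (meson tranclD)
    then have "(v, u) \<in> (parcs G)\<^sup>+"
      using G(3) by (auto simp: rtrancl_eq_or_trancl)
    then have "\<not> acyclic (parcs (out_contract G u v))"
      using out_contract_not_acyclic[OF uv(1)] uv(1) False less.prems(1) by simp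
    with shrink[OF out_contraction[OF uv(1)]] show ?thesis
      using uv(1) G(2) by (auto simp: out_contract_def)
  qed
qed

theorem lemma15:
  fixes G :: "'a pair_pre_digraph"
  assumes "pair_digraph G"
  shows "partial_k_dag 0 G \<longleftrightarrow> \<not> directed_minor K2 G"
  using assms partial_0_dag_iff_acyclic acyclic_imp_not_directed_minor_K2
    not_acyclic_imp_directed_minor_K2 by blast

end
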